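(* Let $\mathcal{A}$ be a unital Banach algebra with unit $1$ and let $a\in\mathcal{A}^\dag\setminus\{0\}$. Suppose that $(a_n)_{n\in\mathbb{N}}\subset\mathcal{A}^\dag$ is a sequence converging to $a$. Then the following statements are equivalent (limits as $n\to\infty$). (i) $a_n^\dag\to a^\dag$. (ii) $a_n^\dag a_n\to a^\dag a$, $aa^\dag(1-a_na_n^\dag)\to0$ and $a_na_n^\dag(1-aa^\dag)\to0$. (iii) $a_na_n^\dag\to aa^\dag$, $(1-a^\dag a)a_n^\dag a_n\to0$ and $(1-a_n^\dag a_n)a^\dag a\to0$. (iv) $(1-a^\dag a)a_n^\dag a_n\to0$, $(1-a_n^\dag a_n)a^\dag a\to0$, $aa^\dag(1-a_na_n^\dag)\to0$ and $a_na_n^\dag(1-aa^\dag)\to0$. (v) $a_na_n^\dag\to aa^\dag$, $a^\dag a(1-a_n^\dag a_n)\to0$ and $a_n^\dag a_n(1-a^\dag a)\to0$. (vi) $a_n^\dag a_n\to a^\dag a$, $(1-aa^\dag)a_na_n^\dag\to0$ and $(1-a_na_n^\dag)aa^\dag\to0$. (vii) $a^\dag a(1-a_n^\dag a_n)\to0$, $a_n^\dag a_n(1-a^\dag a)\to0$, $(1-aa^\dag)a_na_n^\dag\to0$ and $(1-a_na_n^\dag)aa^\dag\to0$. (viii) $a_n^\dag a_n\to a^\dag a$ and $a_na_n^\dag\to aa^\dag$.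
   Context: The unit of $\mathcal{A}$ has norm one. An element $z\in\mathcal{A}$ is hermitian if $\|\exp(itz)\|=1$ for all $t\in\mathbb{R}$. An element $x\in\mathcal{A}$ is Moore-Penrose invertible if there is $y\in\mathcal{A}$ with $x=xyx$, $y=yxy$ and $xy$, $yx$ hermitian; such $y$ is unique when it exists and is denoted $x^\dag$. $\mathcal{A}^\dag$ is the set of Moore-Penrose invertible elements of $\mathcal{A}$. *)

theory Defs
  imports "HOL-Analysis.Analysis"
begin

text \<open>
  The distribution only has real normed algebras. Complex unital Banach algebras are obtained
  by adding a complex scalar multiplication that extends the real one. Completeness comes from
  \<^class>\<open>banach\<close>; submultiplicativity of the norm and \<open>norm 1 = 1\<close> come from
  \<^class>\<open>real_normed_algebra_1\<close>. The real structure is what \<^const>\<open>exp\<close> refers to.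
\<close>

class complex_banach_algebra_1 = real_normed_algebra_1 + banach +
  fixes scaleC :: "complex \<Rightarrow> 'a \<Rightarrow> 'a"  (infixr \<open>*\<^sub>C\<close> 75)
  assumes scaleC_add_right: "c *\<^sub>C (x + y) = c *\<^sub>C x + c *\<^sub>C y"
    and scaleC_add_left: "(c + d) *\<^sub>C x = c *\<^sub>C x + d *\<^sub>C x"
    and scaleC_scaleC: "c *\<^sub>C (d *\<^sub>C x) = (c * d) *\<^sub>C x"
    and scaleC_of_real: "complex_of_real r *\<^sub>C x = r *\<^sub>R x"
    and mult_scaleC_left: "(c *\<^sub>C x) * y = c *\<^sub>C (x * y)"
    and mult_scaleC_right: "x * (c *\<^sub>C y) = c *\<^sub>C (x * y)"
    and norm_scaleC: "norm (c *\<^sub>C x) = cmod c * norm x"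

definition hermitian :: "'a::complex_banach_algebra_1 \<Rightarrow> bool" where
  "hermitian z \<longleftrightarrow> (\<forall>t::real. norm (exp ((\<i> * complex_of_real t) *\<^sub>C z)) = 1)"

definition is_mp_inverse :: "'a::complex_banach_algebra_1 \<Rightarrow> 'a \<Rightarrow> bool" where
  "is_mp_inverse x y \<longleftrightarrow>
     x = x * y * x \<and> y = y * x * y \<and> hermitian (x * y) \<and> hermitian (y * x)"

definition mp_invertible :: "'a::complex_banach_algebra_1 set" where
  "mp_invertible = {x. \<exists>y. is_mp_inverse x y}"

text \<open>Meaningful only for elements of \<open>mp_invertible\<close>; an element outside this set has no
  Moore-Penrose inverse and the value is then unspecified.\<close>

definition mp_inverse :: "'a::complex_banach_algebra_1 \<Rightarrow> 'a"  (\<open>(_\<^sup>\<dagger>)\<close> [1000] 999) where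
  "x\<^sup>\<dagger> = (THE y. is_mp_inverse x y)"

end

theory Submission
  imports Defs
begin

text \<open>
  If \<open>p\<close> is a hermitian idempotent, then \<open>exp (i \<pi> p) = 1 - 2 p\<close> has norm one. For two such
  idempotents with \<open>u v \<approx> v\<close> and \<open>v u \<approx> u\<close>, the element \<open>w = v - u\<close> satisfies \<open>w\<^sup>2 \<approx> 0\<close> and
  \<open>(1 - 2 u) (1 - 2 v) \<approx> 1 + 2 w\<close>. The \<open>k\<close>-th power of the left-hand side is a contraction and
  is close to \<open>1 + 2 k w\<close>, so \<open>w \<approx> 0\<close>. Hence asymptotic equality of the ranges (or of the
  kernels) of hermitian idempotents already forces convergence, and each of the conditions
  (ii) to (vii) is reduced to (viii); exact equality of ranges gives uniqueness of the
  Moore-Penrose inverse. Finally (viii) implies (i) by the perturbation identity for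
  \<open>b - a\<^sup>\<dagger>\<close> with \<open>b\<close> the Moore-Penrose inverse of a nearby element.
\<close>

section \<open>Complex scalars and exponentials of idempotents\<close>

lemma bounded_linear_scaleC_left:
  "bounded_linear (\<lambda>c. c *\<^sub>C (x::'a::complex_banach_algebra_1))"
proof (rule bounded_linear_intro)
  show "(r *\<^sub>R c) *\<^sub>C x = r *\<^sub>R (c *\<^sub>C x)" for r c
    by (metis scaleC_of_real scaleC_scaleC scaleR_conv_of_real)
  show "norm (c *\<^sub>C x) \<le> norm c * norm x" for c
    by (simp add: norm_scaleC)
qed (rule scaleC_add_left)

lemma scaleC_1_left [simp]: "1 *\<^sub>C (x::'a::complex_banach_algebra_1) = x"
  using scaleC_of_real[of 1 x] by simp

lemma exp_scaleC_idempotent: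
  fixes p :: "'a::complex_banach_algebra_1"
  assumes "p * p = p"
  shows "exp (c *\<^sub>C p) = exp c *\<^sub>C p + (1 - p)"
proof -
  interpret L: bounded_linear "\<lambda>c. c *\<^sub>C p"
    by (rule bounded_linear_scaleC_left)
  have pow: "(c *\<^sub>C p) ^ Suc n = c ^ Suc n *\<^sub>C p" for n
  proof (induction n)
    case (Suc n)
    have "(c *\<^sub>C p) ^ Suc (Suc n) = (c *\<^sub>C p) * (c ^ Suc n *\<^sub>C p)"
      using Suc by simp
    also have "\<dots> = c ^ Suc (Suc n) *\<^sub>C p"
      by (simp only: mult_scaleC_left mult_scaleC_right scaleC_scaleC assms power_Suc mult_ac)
    finally show ?case .
  qed simp
  \<comment> \<open>All powers of \<open>p\<close> from the first on equal \<open>p\<close>. The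
    zeroth term is 1 = p + (1 - p), so the series is the scalar exponential series applied to
    \<open>p\<close>, corrected by \<open>1 - p\<close> at \<open>n = 0\<close> only.\<close>
  have "(c *\<^sub>C p) ^ n /\<^sub>R fact n = (c ^ n /\<^sub>R fact n) *\<^sub>C p + (if n = 0 then 1 - p else 0)" for n
    by (cases n) (simp_all only: pow L.scaleR power_0, simp_all)
  moreover have "(\<lambda>n. (c ^ n /\<^sub>R fact n) *\<^sub>C p + (if n = 0 then 1 - p else 0)) sums
      (exp c *\<^sub>C p + (1 - p))"
    by (intro sums_add L.sums exp_converges sums_single)
  ultimately have "(\<lambda>n. (c *\<^sub>C p) ^ n /\<^sub>R fact n) sums (exp c *\<^sub>C p + (1 - p))"
    by simp
  with exp_converges[of "c *\<^sub>C p"] show ?thesis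
    by (rule sums_unique2)
qed

section \<open>Convergence of hermitian idempotents\<close>

lemma hermitian_idempotent_norm_reflection:
  fixes p :: "'a::complex_banach_algebra_1"
  assumes "hermitian p" "p * p = p"
  shows "norm (1 - 2 * p) \<le> 1"
proof -
  have "(- 1) *\<^sub>C p = - p"
    using scaleC_of_real[of "- 1" p] by simp
  hence "exp ((\<i> * complex_of_real pi) *\<^sub>C p) = 1 - 2 * p"
    unfolding exp_scaleC_idempotent[OF assms(2)] by (simp add: mult.commute[of \<i>] mult_2)
  with assms(1) show ?thesis
    unfolding hermitian_def by (metis order_refl)
qed

text \<open>Hermiticity enters only through the bound on the reflections \<open>1 - 2 * u n\<close>
  and \<open>1 - 2 * v n\<close>. In this form the result applies directly to complements
  \<open>1 - p\<close>, whose reflections differ from those of \<open>p\<close> only by a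
  sign.\<close>

lemma idempotent_diff_tendsto_0:
  fixes u v :: "nat \<Rightarrow> 'a::real_normed_algebra_1"
  assumes idem: "\<And>n. u n * u n = u n" "\<And>n. v n * v n = v n"
    and contr: "\<And>n. norm (1 - 2 * u n) \<le> 1" "\<And>n. norm (1 - 2 * v n) \<le> 1"
    and uv: "(\<lambda>n. u n * v n - v n) \<longlonglongrightarrow> 0"
    and vu: "(\<lambda>n. v n * u n - u n) \<longlonglongrightarrow> 0"
  shows "(\<lambda>n. v n - u n) \<longlonglongrightarrow> 0"
proof -
  define w where "w n = v n - u n" for n
  define U where "U n = (1 - 2 * u n) * (1 - 2 * v n)" for n
  have U_norm: "norm (U n) \<le> 1" for n
    unfolding U_def using contr[of n]
    by (meson norm_mult_ineq order_trans mult_le_one norm_ge_zero)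
  have U_pow_norm: "norm (U n ^ k) \<le> 1" for n k
    by (meson U_norm norm_power_ineq order_trans power_le_one norm_ge_zero)
  \<comment> \<open>Twice \<open>w n\<close> is a difference of two reflections. The bound is
    uniform in \<open>n\<close>, which keeps \<open>1 + 2 k w\<close> bounded for fixed
    \<open>k\<close>.\<close>
  have w_norm: "norm (w n) \<le> 1" for n
  proof -
    have "2 *\<^sub>R w n = (1 - 2 * u n) - (1 - 2 * v n)"
      by (simp add: w_def algebra_simps scaleR_2 mult_2)
    hence "norm (2 *\<^sub>R w n) \<le> 1 + 1"
      using contr[of n] by (metis add_mono norm_triangle_ineq4 order_trans)
    thus ?thesis by simp
  qed
  have w2: "(\<lambda>n. w n * w n) \<longlonglongrightarrow> 0"
  proof -
    have "w n * w n = - (u n * v n - v n) - (v n * u n - u n)" for n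
      by (simp add: w_def algebra_simps idem)
    moreover have "(\<lambda>n. - (u n * v n - v n) - (v n * u n - u n)) \<longlonglongrightarrow> - 0 - 0"
      by (intro tendsto_intros uv vu)
    ultimately show ?thesis by simp
  qed
  have U1: "(\<lambda>n. U n - (1 + 2 * w n)) \<longlonglongrightarrow> 0"
  proof -
    have "U n - (1 + 2 * w n) = 2 * (2 * (u n * v n - v n))" for n
      by (simp only: U_def w_def mult_2 mult_2_right) (simp add: algebra_simps)
    moreover have "(\<lambda>n. 2 * (2 * (u n * v n - v n))) \<longlonglongrightarrow> 2 * (2 * 0)"
      by (intro tendsto_intros uv)
    ultimately show ?thesis by simp
  qed
  \<comment> \<open>Here \<open>k\<close> is fixed while \<open>n\<close> grows. The induction step
    rests on (1 + 2 w) (1 + 2 k w) = 1 + 2 (k + 1) w + 4 k w^2: the new error is \<open>U\<close>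
    times the old error, plus the error of \<open>U\<close> times a bounded factor, plus a multiple
    of w^2. Each of the three terms tends to 0.\<close>
  have U_pow: "(\<lambda>n. U n ^ k - (1 + (2 * real k) *\<^sub>R w n)) \<longlonglongrightarrow> 0" for k
  proof (induction k)
    case (Suc k)
    have "norm (1 + (2 * real k) *\<^sub>R w n) \<le> 1 + 2 * real k" for n
      using norm_triangle_ineq[of 1 "(2 * real k) *\<^sub>R w n"]
        mult_left_mono[OF w_norm[of n], of "2 * real k"] by simp
    hence "(\<lambda>n. (U n - (1 + 2 * w n)) * (1 + (2 * real k) *\<^sub>R w n)) \<longlonglongrightarrow> 0"
      using U1 unfolding tendsto_Zfun_iff diff_0_right
      by (intro bounded_bilinear.Zfun_prod_Bfun[OF bounded_bilinear_mult] BfunI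
          always_eventually allI)
    moreover have "(\<lambda>n. U n * (U n ^ k - (1 + (2 * real k) *\<^sub>R w n))) \<longlonglongrightarrow> 0"
      using Suc U_norm unfolding tendsto_Zfun_iff diff_0_right
      by (intro bounded_bilinear.Bfun_prod_Zfun[OF bounded_bilinear_mult] BfunI
          always_eventually allI)
    moreover have "(\<lambda>n. (4 * real k) *\<^sub>R (w n * w n)) \<longlonglongrightarrow> (4 * real k) *\<^sub>R 0"
      by (intro tendsto_intros w2)
    ultimately have "(\<lambda>n. U n * (U n ^ k - (1 + (2 * real k) *\<^sub>R w n))
        + (U n - (1 + 2 * w n)) * (1 + (2 * real k) *\<^sub>R w n)
        + (4 * real k) *\<^sub>R (w n * w n)) \<longlonglongrightarrow> 0 + 0 + (4 * real k) *\<^sub>R 0"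
      by (intro tendsto_add)
    moreover have "U n * (U n ^ k - (1 + (2 * real k) *\<^sub>R w n))
        + (U n - (1 + 2 * w n)) * (1 + (2 * real k) *\<^sub>R w n)
        + (4 * real k) *\<^sub>R (w n * w n) = U n ^ Suc k - (1 + (2 * real (Suc k)) *\<^sub>R w n)" for n
    proof -
      have ring: "U n * (A - (1 + X)) + (U n - (1 + 2 * w n)) * (1 + X) + 2 * (w n * X)
          = U n * A - (1 + (X + 2 * w n))" for A X
        by (simp add: algebra_simps mult_2)
      have "(4 * real k) *\<^sub>R (w n * w n) = 2 * (w n * ((2 * real k) *\<^sub>R w n))"
        unfolding mult_2[of "w n * _"] by (simp flip: scaleR_2)
      moreover have "(2 * real (Suc k)) *\<^sub>R w n = (2 * real k) *\<^sub>R w n + 2 * w n"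
        by (simp add: scaleR_left_distrib scaleR_2 mult_2[of "w n"] distrib_left)
      ultimately show ?thesis by (simp only: ring power_Suc)
    qed
    ultimately show ?case by simp
  qed simp
  have "w \<longlonglongrightarrow> 0"
  proof (rule LIMSEQ_I)
    fix r :: real
    assume "r > 0"
    \<comment> \<open>The exponent is chosen before \<open>n\<close>. The number 3 bounds the norm
      of 2 k w: at most 1 from the power of \<open>U\<close>, 1 from the unit, and less than 1 from
      the error for large \<open>n\<close>. So k times the norm of w is at most 3/2, hence below k
      r.\<close>
    then obtain k where k: "3 < real k * r"
      using reals_Archimedean3 by blast
    obtain N where N: "\<And>n. n \<ge> N \<Longrightarrow> norm (U n ^ k - (1 + (2 * real k) *\<^sub>R w n)) < 1"
      using LIMSEQ_D[OF U_pow[of k], of 1] by auto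
    have "norm (w n) < r" if "n \<ge> N" for n
    proof -
      have "(2 * real k) *\<^sub>R w n = U n ^ k - 1 - (U n ^ k - (1 + (2 * real k) *\<^sub>R w n))"
        by simp
      also have "norm \<dots> \<le> norm (U n ^ k) + norm (1::'a) + 1"
        using N[OF that] norm_triangle_ineq4[of "U n ^ k" 1]
          norm_triangle_ineq4[of "U n ^ k - 1" "U n ^ k - (1 + (2 * real k) *\<^sub>R w n)"]
        by linarith
      finally have "2 * (real k * norm (w n)) \<le> 3"
        using U_pow_norm[of n k] by simp
      hence "real k * norm (w n) < real k * r"
        using k by linarith
      thus ?thesis
        by (simp add: mult_less_cancel_left)
    qed
    thus "\<exists>no. \<forall>n\<ge>no. norm (w n - 0) < r" by auto
  qed
  thus ?thesis by (simp add: w_def[abs_def])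
qed

text \<open>The right-hand side says that each idempotent asymptotically fixes the range of the
  other. Up to sign, these are the two hypotheses of \<open>idempotent_diff_tendsto_0\<close>; the
  other direction is continuity together with (1 - v) v = 0.\<close>

lemma tendsto_idempotent_iff_range:
  fixes u :: "nat \<Rightarrow> 'a::complex_banach_algebra_1"
  assumes u: "\<And>n. u n * u n = u n" "\<And>n. hermitian (u n)"
    and v: "v * v = v" "hermitian v"
  shows "u \<longlonglongrightarrow> v \<longleftrightarrow> (\<lambda>n. (1 - v) * u n) \<longlonglongrightarrow> 0 \<and> (\<lambda>n. (1 - u n) * v) \<longlonglongrightarrow> 0"
proof
  assume u_lim: "u \<longlonglongrightarrow> v"
  have "(\<lambda>n. (1 - v) * u n) \<longlonglongrightarrow> (1 - v) * v" "(\<lambda>n. (1 - u n) * v) \<longlonglongrightarrow> (1 - v) * v"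
    by (intro tendsto_intros u_lim)+
  thus "(\<lambda>n. (1 - v) * u n) \<longlonglongrightarrow> 0 \<and> (\<lambda>n. (1 - u n) * v) \<longlonglongrightarrow> 0"
    by (simp add: algebra_simps v)
next
  assume lim: "(\<lambda>n. (1 - v) * u n) \<longlonglongrightarrow> 0 \<and> (\<lambda>n. (1 - u n) * v) \<longlonglongrightarrow> 0"
  have "(\<lambda>n. v - u n) \<longlonglongrightarrow> 0"
  proof (rule idempotent_diff_tendsto_0)
    show "(\<lambda>n. u n * v - v) \<longlonglongrightarrow> 0"
      using tendsto_minus[OF lim[THEN conjunct2]] by (simp add: algebra_simps)
    show "(\<lambda>n. v * u n - u n) \<longlonglongrightarrow> 0"
      using tendsto_minus[OF lim[THEN conjunct1]] by (simp add: algebra_simps)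
  qed (use u v hermitian_idempotent_norm_reflection in auto)
  from tendsto_diff[OF tendsto_const[of v] this] show "u \<longlonglongrightarrow> v" by simp
qed

text \<open>The kernel of \<open>p\<close> is the range of \<open>1 - p\<close>, so the argument for
  ranges is repeated for the complements: (1 - u) (1 - v) - (1 - v) = - u (1 - v), and likewise with
  \<open>u\<close> and \<open>v\<close> exchanged.\<close>

lemma tendsto_idempotent_iff_kernel:
  fixes u :: "nat \<Rightarrow> 'a::complex_banach_algebra_1"
  assumes u: "\<And>n. u n * u n = u n" "\<And>n. hermitian (u n)"
    and v: "v * v = v" "hermitian v"
  shows "u \<longlonglongrightarrow> v \<longleftrightarrow> (\<lambda>n. v * (1 - u n)) \<longlonglongrightarrow> 0 \<and> (\<lambda>n. u n * (1 - v)) \<longlonglongrightarrow> 0"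
proof
  assume u_lim: "u \<longlonglongrightarrow> v"
  have "(\<lambda>n. v * (1 - u n)) \<longlonglongrightarrow> v * (1 - v)" "(\<lambda>n. u n * (1 - v)) \<longlonglongrightarrow> v * (1 - v)"
    by (intro tendsto_intros u_lim)+
  thus "(\<lambda>n. v * (1 - u n)) \<longlonglongrightarrow> 0 \<and> (\<lambda>n. u n * (1 - v)) \<longlonglongrightarrow> 0"
    by (simp add: algebra_simps v)
next
  assume lim: "(\<lambda>n. v * (1 - u n)) \<longlonglongrightarrow> 0 \<and> (\<lambda>n. u n * (1 - v)) \<longlonglongrightarrow> 0"
  have refl: "norm (1 - 2 * (1 - p)) \<le> 1" if "p * p = p" "hermitian p" for p :: 'a
  proof -
    have "1 - 2 * (1 - p) = - (1 - 2 * p)" by (simp add: algebra_simps)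
    thus ?thesis
      using hermitian_idempotent_norm_reflection[OF that(2,1)] by (metis norm_minus_cancel)
  qed
  have "(\<lambda>n. (1 - v) - (1 - u n)) \<longlonglongrightarrow> 0"
  proof (rule idempotent_diff_tendsto_0)
    show "(\<lambda>n. (1 - u n) * (1 - v) - (1 - v)) \<longlonglongrightarrow> 0"
      using tendsto_minus[OF lim[THEN conjunct2]] by (simp add: algebra_simps)
    show "(\<lambda>n. (1 - v) * (1 - u n) - (1 - u n)) \<longlonglongrightarrow> 0"
      using tendsto_minus[OF lim[THEN conjunct1]] by (simp add: algebra_simps)
  qed (use u v refl in \<open>simp_all add: algebra_simps\<close>)
  from tendsto_add[OF this tendsto_const[of v]] show "u \<longlonglongrightarrow> v" by simp
qed

text \<open>The idempotents \<open>x * y\<close> and \<open>x * z\<close> have the same range, and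
  \<open>y * x\<close> and \<open>z * x\<close> the same kernel. The convergence criteria for
  constant sequences then give equality, since a constant sequence converges only to its value.
  Finally y = y x y = z x y = z x z = z.\<close>

lemma is_mp_inverse_unique:
  assumes y: "is_mp_inverse x y" and z: "is_mp_inverse x z"
  shows "y = z"
proof -
  note yD = y[unfolded is_mp_inverse_def] and zD = z[unfolded is_mp_inverse_def]
  have prods: "x * y * x = x" "x * z * x = x" "y * x * y = y" "z * x * z = z"
    using yD zD by simp_all
  hence prods': "x * (y * x) = x" "x * (z * x) = x" "y * (x * y) = y" "z * (x * z) = z"
    "x * (y * (x * t)) = x * t" "x * (z * (x * t)) = x * t"
    "y * (x * (y * t)) = y * t" "z * (x * (z * t)) = z * t" for t
    by (metis mult.assoc)+
  have "(\<lambda>n::nat. x * y) \<longlonglongrightarrow> x * z"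
    by (subst tendsto_idempotent_iff_range) (use yD zD in \<open>simp_all add: algebra_simps prods'\<close>)
  moreover have "(\<lambda>n::nat. y * x) \<longlonglongrightarrow> z * x"
    by (subst tendsto_idempotent_iff_kernel) (use yD zD in \<open>simp_all add: algebra_simps prods'\<close>)
  ultimately have "x * y = x * z" "y * x = z * x"
    by (simp_all add: LIMSEQ_const_iff)
  thus ?thesis
    by (metis prods(3,4) mult.assoc)
qed

section \<open>The Moore-Penrose inverse and its continuity\<close>

lemma mp_inverse:
  assumes "x \<in> mp_invertible"
  shows "is_mp_inverse x (x\<^sup>\<dagger>)"
  using assms unfolding mp_invertible_def mp_inverse_def
  by (auto intro: theI is_mp_inverse_unique)

lemma mp_inverse_mult:
  assumes "x \<in> mp_invertible"
  shows "x * x\<^sup>\<dagger> * x = x" "x\<^sup>\<dagger> * x * x\<^sup>\<dagger> = x\<^sup>\<dagger>"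
  using mp_inverse[OF assms] by (simp_all add: is_mp_inverse_def)

lemma mp_inverse_idempotent:
  assumes "x \<in> mp_invertible"
  shows "x * x\<^sup>\<dagger> * (x * x\<^sup>\<dagger>) = x * x\<^sup>\<dagger>" "x\<^sup>\<dagger> * x * (x\<^sup>\<dagger> * x) = x\<^sup>\<dagger> * x"
  using mp_inverse_mult[OF assms] by (metis mult.assoc)+

lemma mp_inverse_hermitian:
  assumes "x \<in> mp_invertible"
  shows "hermitian (x * x\<^sup>\<dagger>)" "hermitian (x\<^sup>\<dagger> * x)"
  using mp_inverse[OF assms] by (simp_all add: is_mp_inverse_def)

lemma tendsto_mp_inverse:
  assumes a: "a \<in> mp_invertible" and s: "\<And>n. s n \<in> mp_invertible"
    and lim: "s \<longlonglongrightarrow> a"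
    and P: "(\<lambda>n. (s n)\<^sup>\<dagger> * s n) \<longlonglongrightarrow> a\<^sup>\<dagger> * a"
    and Q: "(\<lambda>n. s n * (s n)\<^sup>\<dagger>) \<longlonglongrightarrow> a * a\<^sup>\<dagger>"
  shows "(\<lambda>n. (s n)\<^sup>\<dagger>) \<longlonglongrightarrow> a\<^sup>\<dagger>"
proof -
  \<comment> \<open>With b the inverse of \<open>s n\<close>, the choice of \<open>c\<close> and
    \<open>d\<close> makes \<open>b - a\<^sup>\<dagger>\<close> equal to b c - d: the product b c
    collapses to \<open>b - b * s n * a\<^sup>\<dagger>\<close>. Convergence of the idempotents
    \<open>s n * b\<close> sends \<open>c\<close> to 0, that of \<open>b * s n\<close> sends
    \<open>d\<close> to 0.\<close>
  define c where "c n = s n * (s n)\<^sup>\<dagger> * (1 - a * a\<^sup>\<dagger>) - (s n - a) * a\<^sup>\<dagger>" for n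
  define d where "d n = (a\<^sup>\<dagger> * a - (s n)\<^sup>\<dagger> * s n) * a\<^sup>\<dagger>" for n
  have "c \<longlonglongrightarrow> a * a\<^sup>\<dagger> * (1 - a * a\<^sup>\<dagger>) - (a - a) * a\<^sup>\<dagger>"
    unfolding c_def[abs_def] by (intro tendsto_intros Q lim)
  hence c: "c \<longlonglongrightarrow> 0"
    by (simp add: right_diff_distrib mp_inverse_idempotent[OF a])
  have "d \<longlonglongrightarrow> (a\<^sup>\<dagger> * a - a\<^sup>\<dagger> * a) * a\<^sup>\<dagger>"
    unfolding d_def[abs_def] by (intro tendsto_intros P)
  hence d: "d \<longlonglongrightarrow> 0" by simp
  have "(s n)\<^sup>\<dagger> * (s n * ((s n)\<^sup>\<dagger> * t)) = (s n)\<^sup>\<dagger> * t" "(s n)\<^sup>\<dagger> * (s n * (s n)\<^sup>\<dagger>) = (s n)\<^sup>\<dagger>"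
    "a\<^sup>\<dagger> * (a * a\<^sup>\<dagger>) = a\<^sup>\<dagger>" for n t
    using mp_inverse_mult(2)[OF s[of n]] mp_inverse_mult(2)[OF a] by (metis mult.assoc)+
  hence "(s n)\<^sup>\<dagger> - a\<^sup>\<dagger> = (s n)\<^sup>\<dagger> * c n - d n" for n
    by (simp add: c_def d_def algebra_simps)
  \<comment> \<open>No bound on the inverses of \<open>s n\<close> is known yet, so the factor b is
    split as \<open>(b - a\<^sup>\<dagger>) + a\<^sup>\<dagger>\<close>. Once the norm of
    \<open>c n\<close> is below 1/2, the first part is absorbed into the left-hand side.\<close>
  hence "(s n)\<^sup>\<dagger> - a\<^sup>\<dagger> = ((s n)\<^sup>\<dagger> - a\<^sup>\<dagger>) * c n + a\<^sup>\<dagger> * c n - d n" for n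
    by (simp add: algebra_simps)
  hence bound: "norm ((s n)\<^sup>\<dagger> - a\<^sup>\<dagger>) \<le>
      norm ((s n)\<^sup>\<dagger> - a\<^sup>\<dagger>) * norm (c n) + norm (a\<^sup>\<dagger> * c n - d n)" for n
    by (smt (verit) add_diff_eq norm_triangle_ineq norm_mult_ineq)
  have "\<forall>\<^sub>F n in sequentially. norm (c n) < 1 / 2"
    using order_tendstoD(2)[OF tendsto_norm_zero[OF c], of "1 / 2"] by simp
  hence "\<forall>\<^sub>F n in sequentially. norm ((s n)\<^sup>\<dagger> - a\<^sup>\<dagger>) \<le> 2 * norm (a\<^sup>\<dagger> * c n - d n)"
  proof eventually_elim
    case (elim n)
    have "norm ((s n)\<^sup>\<dagger> - a\<^sup>\<dagger>) * norm (c n) \<le> norm ((s n)\<^sup>\<dagger> - a\<^sup>\<dagger>) * (1 / 2)"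
      using elim by (intro mult_left_mono) auto
    with bound[of n] show ?case by linarith
  qed
  moreover have "(\<lambda>n. 2 * norm (a\<^sup>\<dagger> * c n - d n)) \<longlonglongrightarrow> 2 * norm (a\<^sup>\<dagger> * 0 - 0)"
    by (intro tendsto_intros c d)
  hence "(\<lambda>n. 2 * norm (a\<^sup>\<dagger> * c n - d n)) \<longlonglongrightarrow> 0"
    by simp
  ultimately have "(\<lambda>n. (s n)\<^sup>\<dagger> - a\<^sup>\<dagger>) \<longlonglongrightarrow> 0"
    by (rule Lim_null_comparison)
  thus ?thesis by (rule LIM_zero_cancel)
qed

theorem corollary5p7:
  fixes a :: "'a::complex_banach_algebra_1" and s :: "nat \<Rightarrow> 'a"
  assumes a_mp: "a \<in> mp_invertible - {0}"
    and s_mp: "\<And>n. s n \<in> mp_invertible"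
    and lim: "s \<longlonglongrightarrow> a"
  shows "
    (((\<lambda>n. (s n)\<^sup>\<dagger>) \<longlonglongrightarrow> a\<^sup>\<dagger>) \<longleftrightarrow>
       ((\<lambda>n. (s n)\<^sup>\<dagger> * s n) \<longlonglongrightarrow> a\<^sup>\<dagger> * a) \<and>
       ((\<lambda>n. a * a\<^sup>\<dagger> * (1 - s n * (s n)\<^sup>\<dagger>)) \<longlonglongrightarrow> 0) \<and>
       ((\<lambda>n. s n * (s n)\<^sup>\<dagger> * (1 - a * a\<^sup>\<dagger>)) \<longlonglongrightarrow> 0)) \<and>
    (((\<lambda>n. (s n)\<^sup>\<dagger>) \<longlonglongrightarrow> a\<^sup>\<dagger>) \<longleftrightarrow>
       ((\<lambda>n. s n * (s n)\<^sup>\<dagger>) \<longlonglongrightarrow> a * a\<^sup>\<dagger>) \<and>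
       ((\<lambda>n. (1 - a\<^sup>\<dagger> * a) * ((s n)\<^sup>\<dagger> * s n)) \<longlonglongrightarrow> 0) \<and>
       ((\<lambda>n. (1 - (s n)\<^sup>\<dagger> * s n) * (a\<^sup>\<dagger> * a)) \<longlonglongrightarrow> 0)) \<and>
    (((\<lambda>n. (s n)\<^sup>\<dagger>) \<longlonglongrightarrow> a\<^sup>\<dagger>) \<longleftrightarrow>
       ((\<lambda>n. (1 - a\<^sup>\<dagger> * a) * ((s n)\<^sup>\<dagger> * s n)) \<longlonglongrightarrow> 0) \<and>
       ((\<lambda>n. (1 - (s n)\<^sup>\<dagger> * s n) * (a\<^sup>\<dagger> * a)) \<longlonglongrightarrow> 0) \<and>
       ((\<lambda>n. a * a\<^sup>\<dagger> * (1 - s n * (s n)\<^sup>\<dagger>)) \<longlonglongrightarrow> 0) \<and>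
       ((\<lambda>n. s n * (s n)\<^sup>\<dagger> * (1 - a * a\<^sup>\<dagger>)) \<longlonglongrightarrow> 0)) \<and>
    (((\<lambda>n. (s n)\<^sup>\<dagger>) \<longlonglongrightarrow> a\<^sup>\<dagger>) \<longleftrightarrow>
       ((\<lambda>n. s n * (s n)\<^sup>\<dagger>) \<longlonglongrightarrow> a * a\<^sup>\<dagger>) \<and>
       ((\<lambda>n. a\<^sup>\<dagger> * a * (1 - (s n)\<^sup>\<dagger> * s n)) \<longlonglongrightarrow> 0) \<and>
       ((\<lambda>n. (s n)\<^sup>\<dagger> * s n * (1 - a\<^sup>\<dagger> * a)) \<longlonglongrightarrow> 0)) \<and>
    (((\<lambda>n. (s n)\<^sup>\<dagger>) \<longlonglongrightarrow> a\<^sup>\<dagger>) \<longleftrightarrow>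
       ((\<lambda>n. (s n)\<^sup>\<dagger> * s n) \<longlonglongrightarrow> a\<^sup>\<dagger> * a) \<and>
       ((\<lambda>n. (1 - a * a\<^sup>\<dagger>) * (s n * (s n)\<^sup>\<dagger>)) \<longlonglongrightarrow> 0) \<and>
       ((\<lambda>n. (1 - s n * (s n)\<^sup>\<dagger>) * (a * a\<^sup>\<dagger>)) \<longlonglongrightarrow> 0)) \<and>
    (((\<lambda>n. (s n)\<^sup>\<dagger>) \<longlonglongrightarrow> a\<^sup>\<dagger>) \<longleftrightarrow>
       ((\<lambda>n. a\<^sup>\<dagger> * a * (1 - (s n)\<^sup>\<dagger> * s n)) \<longlonglongrightarrow> 0) \<and>
       ((\<lambda>n. (s n)\<^sup>\<dagger> * s n * (1 - a\<^sup>\<dagger> * a)) \<longlonglongrightarrow> 0) \<and>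
       ((\<lambda>n. (1 - a * a\<^sup>\<dagger>) * (s n * (s n)\<^sup>\<dagger>)) \<longlonglongrightarrow> 0) \<and>
       ((\<lambda>n. (1 - s n * (s n)\<^sup>\<dagger>) * (a * a\<^sup>\<dagger>)) \<longlonglongrightarrow> 0)) \<and>
    (((\<lambda>n. (s n)\<^sup>\<dagger>) \<longlonglongrightarrow> a\<^sup>\<dagger>) \<longleftrightarrow>
       ((\<lambda>n. (s n)\<^sup>\<dagger> * s n) \<longlonglongrightarrow> a\<^sup>\<dagger> * a) \<and>
       ((\<lambda>n. s n * (s n)\<^sup>\<dagger>) \<longlonglongrightarrow> a * a\<^sup>\<dagger>))"
proof -
  have a: "a \<in> mp_invertible" using a_mp by simp
  define p where "p n = (s n)\<^sup>\<dagger> * s n" for n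
  define q where "q n = s n * (s n)\<^sup>\<dagger>" for n
  define e where "e = a\<^sup>\<dagger> * a"
  define f where "f = a * a\<^sup>\<dagger>"
  have p: "p n * p n = p n" "hermitian (p n)"
    and q: "q n * q n = q n" "hermitian (q n)" for n
    by (simp_all add: p_def q_def mp_inverse_idempotent mp_inverse_hermitian s_mp)
  have e: "e * e = e" "hermitian e" and f: "f * f = f" "hermitian f"
    by (simp_all add: e_def f_def mp_inverse_idempotent mp_inverse_hermitian a)
  \<comment> \<open>This is the equivalence of (i) and (viii); the forward direction is continuity
    of multiplication.\<close>
  have iff: "(\<lambda>n. (s n)\<^sup>\<dagger>) \<longlonglongrightarrow> a\<^sup>\<dagger> \<longleftrightarrow> p \<longlonglongrightarrow> e \<and> q \<longlonglongrightarrow> f"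
  proof
    assume "(\<lambda>n. (s n)\<^sup>\<dagger>) \<longlonglongrightarrow> a\<^sup>\<dagger>"
    from tendsto_mult[OF this lim] tendsto_mult[OF lim this] show "p \<longlonglongrightarrow> e \<and> q \<longlonglongrightarrow> f"
      unfolding p_def[abs_def] q_def[abs_def] e_def f_def ..
  next
    assume "p \<longlonglongrightarrow> e \<and> q \<longlonglongrightarrow> f"
    thus "(\<lambda>n. (s n)\<^sup>\<dagger>) \<longlonglongrightarrow> a\<^sup>\<dagger>"
      unfolding p_def[abs_def] q_def[abs_def] e_def f_def
      using tendsto_mp_inverse[OF a s_mp lim] by blast
  qed
  have p_range: "p \<longlonglongrightarrow> e \<longleftrightarrow> (\<lambda>n. (1 - e) * p n) \<longlonglongrightarrow> 0 \<and> (\<lambda>n. (1 - p n) * e) \<longlonglongrightarrow> 0"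
    by (rule tendsto_idempotent_iff_range[OF p e])
  have p_kernel: "p \<longlonglongrightarrow> e \<longleftrightarrow> (\<lambda>n. e * (1 - p n)) \<longlonglongrightarrow> 0 \<and> (\<lambda>n. p n * (1 - e)) \<longlonglongrightarrow> 0"
    by (rule tendsto_idempotent_iff_kernel[OF p e])
  have q_range: "q \<longlonglongrightarrow> f \<longleftrightarrow> (\<lambda>n. (1 - f) * q n) \<longlonglongrightarrow> 0 \<and> (\<lambda>n. (1 - q n) * f) \<longlonglongrightarrow> 0"
    by (rule tendsto_idempotent_iff_range[OF q f])
  have q_kernel: "q \<longlonglongrightarrow> f \<longleftrightarrow> (\<lambda>n. f * (1 - q n)) \<longlonglongrightarrow> 0 \<and> (\<lambda>n. q n * (1 - f)) \<longlonglongrightarrow> 0"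
    by (rule tendsto_idempotent_iff_kernel[OF q f])
  \<comment> \<open>Each of (ii) to (vii) is (viii) with the limit of \<open>p\<close>, of
    \<open>q\<close>, or of both replaced by a range or kernel criterion, so only propositional
    reasoning remains.\<close>
  show ?thesis
    unfolding iff
    unfolding p_def[symmetric] q_def[symmetric] e_def[symmetric] f_def[symmetric]
    using p_range p_kernel q_range q_kernel by argo
qed

end
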